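(* Let $E\subsetneq\partial\mathbb{D}$ be a closed set. Then there exists a one-component bounded function $b$ such that $\mathrm{spec}(b)=E$.
   Context: $\mathbb{D}$ is the open unit disc and $H^\infty(\mathbb{D})$ the bounded analytic functions on $\mathbb{D}$, $\|b\|_\infty=\sup_{\mathbb{D}}|b|$. For $b\in H^\infty(\mathbb{D})$ with $\|b\|_\infty=1$, the spectrum of $b$ is $\mathrm{spec}(b)=\{\xi\in\partial\mathbb{D}: \liminf_{z\to\xi, z\in\mathbb{D}}|b(z)|<1\}$. Such a $b$ is called one-component (a one-component bounded function) if there is a constant $0<C<1$ such that (a) $\mathrm{spec}(b)\subseteq\overline{\{z\in\mathbb{D}:|b(z)|\le C\}}$ and (b) the set $\{z\in\mathbb{D}:|b(z)|<C\}$ is connected. *)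

theory Defs
  imports "HOL-Complex_Analysis.Complex_Analysis" "HOL-Library.Liminf_Limsup"
begin

definition Hinf_unit :: "(complex \<Rightarrow> complex) \<Rightarrow> bool" where
  "Hinf_unit b \<longleftrightarrow> b holomorphic_on ball 0 1 \<and> bounded (b ` ball 0 1)
     \<and> (SUP z\<in>ball 0 1. norm (b z)) = 1"

definition spec :: "(complex \<Rightarrow> complex) \<Rightarrow> complex set" where
  "spec b = {\<xi> \<in> sphere 0 1.
     Liminf (at \<xi> within ball 0 1) (\<lambda>z. ereal (norm (b z))) < 1}"

definition one_component :: "(complex \<Rightarrow> complex) \<Rightarrow> bool" where
  "one_component b \<longleftrightarrow> Hinf_unit b \<and>
     (\<exists>C::real. 0 < C \<and> C < 1 \<and>
        spec b \<subseteq> closure {z \<in> ball 0 1. norm (b z) \<le> C} \<and>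
        connected {z \<in> ball 0 1. norm (b z) < C})"

end

theory Submission
  imports Defs
begin

text \<open>
  Take \<open>b = exp (-F)\<close>, where \<open>u = Re F\<close> is the Poisson integral of a measure on \<open>E\<close>: the image of
  Lebesgue measure on an interval of angles under the map sending each angle to the last angle
  of \<open>E\<close> before it. As the measure lives on \<open>E\<close>, \<open>u\<close> tends to \<open>0\<close> at every other boundary point.

  Let \<open>G\<close> be the set of points \<open>z\<close> with \<open>(1 + |z|\<^sup>2) |z - e|\<^sup>2 \<le> (1 - |z|\<^sup>2)\<^sup>2\<close> for some \<open>e \<in> E\<close>; it
  contains the radii ending in \<open>E\<close>. Near such an \<open>e\<close> the measure has mass comparable to \<open>1 - |z|\<close>,
  so \<open>u \<ge> 1/4\<close> on \<open>G\<close>. Outside \<open>G\<close> every Poisson kernel with pole in \<open>E\<close> decreases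
  radially towards the circle. Hence \<open>{u > 1/8}\<close> is star-shaped about \<open>0\<close>.
\<close>

section \<open>The Poisson kernel along a radius\<close>

definition poisson_kernel :: "complex \<Rightarrow> complex \<Rightarrow> real" where
  "poisson_kernel w z = (1 - (norm z)\<^sup>2) / (norm (w - z))\<^sup>2"

lemma Re_herglotz_kernel:
  assumes "norm w = 1"
  shows "Re ((w + z) / (w - z)) = poisson_kernel w z"
proof -
  have w: "(Re w)\<^sup>2 + (Im w)\<^sup>2 = 1"
    using assms by (metis cmod_power2 one_power2)
  show ?thesis
    unfolding poisson_kernel_def Re_divide cmod_power2 using w
    by (simp add: power2_eq_square algebra_simps)
qed

lemma poisson_kernel_nonneg: "norm z \<le> 1 \<Longrightarrow> 0 \<le> poisson_kernel w z"
  by (simp add: poisson_kernel_def abs_square_le_1)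

text \<open>With \<open>c\<close> the real inner product of \<open>z\<close> and \<open>w\<close>
  and \<open>r = norm z\<close>, the derivative of the kernel along the radius has at
  \<open>s\<close> the sign of c (1 + s^2 r^2) - 2 s r^2, and \<open>far\<close> says that this is
  negative. Since 2 s / (1 + s^2 r^2) increases in \<open>s\<close> while s r < 1, the sign stays
  negative from \<open>s\<close> out to 1. Hence \<open>far\<close> is required at the inner point
  alone. The proof compares the two values by cross-multiplication instead of
  differentiating.\<close>

lemma poisson_kernel_radial_decreasing:
  assumes w: "norm w = 1" and z: "norm z < 1" and s: "0 \<le> s" "s \<le> 1"
    and far: "(1 - (norm (s *\<^sub>R z))\<^sup>2)\<^sup>2 < (1 + (norm (s *\<^sub>R z))\<^sup>2) * (norm (w - s *\<^sub>R z))\<^sup>2"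
  shows "poisson_kernel w z \<le> poisson_kernel w (s *\<^sub>R z)"
proof -
  define r where "r = norm z"
  define c where "c = Re z * Re w + Im z * Im w"
  have r: "0 \<le> r" "r < 1" using z by (auto simp: r_def)
  have w2: "(Re w)\<^sup>2 + (Im w)\<^sup>2 = 1"
    using w by (metis cmod_power2 one_power2)
  have dist: "(norm (w - t *\<^sub>R z))\<^sup>2 = 1 - 2 * t * c + t\<^sup>2 * r\<^sup>2" for t
    unfolding r_def c_def cmod_power2 using w2
    by (simp add: power2_eq_square algebra_simps)
  have nsz: "(norm (s *\<^sub>R z))\<^sup>2 = s\<^sup>2 * r\<^sup>2"
    using s by (simp add: r_def power_mult_distrib)
  have "(1 - s\<^sup>2 * r\<^sup>2)\<^sup>2 < (1 + s\<^sup>2 * r\<^sup>2) * (1 - 2 * s * c + s\<^sup>2 * r\<^sup>2)"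
    using far by (simp only: dist nsz)
  then have "2 * s * (c * (1 + s\<^sup>2 * r\<^sup>2)) < 2 * s * (2 * s * r\<^sup>2)"
    by (simp add: power2_eq_square algebra_simps)
  \<comment> \<open>At \<open>s = 0\<close> the strict inequality \<open>far\<close> would read 1 <
    1, so the factor 2 s is positive and cancels.\<close>
  then have c1: "c * (1 + s\<^sup>2 * r\<^sup>2) < 2 * s * r\<^sup>2"
    using s by (metis mult_less_cancel_left_disj mult_nonneg_nonneg not_less zero_le_numeral)
  \<comment> \<open>After cross-multiplication the difference of the two sides of the claim is 2 (1
    - s) times the slack in this inequality.\<close>
  have c2: "c * (1 + s * r\<^sup>2) \<le> (1 + s) * r\<^sup>2"
  proof (cases "c \<le> 0")
    case True
    have "c * (1 + s * r\<^sup>2) \<le> 0"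
      using True s by (intro mult_nonpos_nonneg) auto
    also have "0 \<le> (1 + s) * r\<^sup>2" using s by auto
    finally show ?thesis .
  next
    case False
    have sr: "s\<^sup>2 * r\<^sup>2 \<le> 1" using s r
      by (metis abs_square_le_1 less_eq_real_def mult_le_one power2_abs power_le_one zero_le_power2 abs_of_nonneg)
    have "(1 + s * r\<^sup>2) * (c * (1 + s\<^sup>2 * r\<^sup>2)) \<le> (1 + s * r\<^sup>2) * (2 * s * r\<^sup>2)"
      using c1 s by (intro mult_left_mono) auto
    also have "\<dots> \<le> (1 + s) * r\<^sup>2 * (1 + s\<^sup>2 * r\<^sup>2)"
    proof -
      \<comment> \<open>This product is exactly the difference of the two sides.\<close>
      have "0 \<le> r\<^sup>2 * ((1 - s) * (1 - s\<^sup>2 * r\<^sup>2))"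
        using s sr by (intro mult_nonneg_nonneg) auto
      then show ?thesis by (simp add: power2_eq_square algebra_simps)
    qed
    finally have "(c * (1 + s * r\<^sup>2)) * (1 + s\<^sup>2 * r\<^sup>2) \<le> ((1 + s) * r\<^sup>2) * (1 + s\<^sup>2 * r\<^sup>2)"
      by (simp add: algebra_simps)
    moreover have "0 < 1 + s\<^sup>2 * r\<^sup>2" by (simp add: add_pos_nonneg)
    ultimately show ?thesis using mult_le_cancel_right_pos by blast
  qed
  have "0 \<le> 2 * (1 - s) * ((1 + s) * r\<^sup>2 - c * (1 + s * r\<^sup>2))"
    using s c2 by (intro mult_nonneg_nonneg) auto
  then have main: "(1 - r\<^sup>2) * (1 - 2 * s * c + s\<^sup>2 * r\<^sup>2) \<le> (1 - s\<^sup>2 * r\<^sup>2) * (1 - 2 * c + r\<^sup>2)"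
    by (simp add: power2_eq_square algebra_simps)
  have "norm (s *\<^sub>R z) \<le> norm z"
    using s by (simp add: mult_left_le_one_le)
  then have "w \<noteq> z" "w \<noteq> s *\<^sub>R z" using w z by force+
  then have "0 < (norm (w - z))\<^sup>2" "0 < (norm (w - s *\<^sub>R z))\<^sup>2" by auto
  moreover have "(1 - (norm z)\<^sup>2) * (norm (w - s *\<^sub>R z))\<^sup>2
      \<le> (1 - (norm (s *\<^sub>R z))\<^sup>2) * (norm (w - z))\<^sup>2"
    using main dist[of 1] dist[of s] nsz by (simp add: r_def)
  ultimately show ?thesis
    unfolding poisson_kernel_def by (simp only: pos_divide_le_eq pos_le_divide_eq times_divide_eq_left)
qed

section \<open>Herglotz integrals of measures on the unit circle\<close>

locale circle_measure = finite_measure M for M :: "'a measure" +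
  fixes p :: "'a \<Rightarrow> complex"
  assumes p_measurable [measurable]: "p \<in> borel_measurable M"
    and p_sphere: "\<And>x. norm (p x) = 1"
begin

text \<open>The Herglotz integral of the image measure of \<open>M\<close> under \<open>p\<close>,
  without the usual factor 1/(2 pi). Keeping the parametrization \<open>p\<close> means that the
  image measure never has to be formed.\<close>

definition herglotz :: "complex \<Rightarrow> complex" where
  "herglotz z = (\<integral>x. (p x + z) / (p x - z) \<partial>M)"

lemma norm_p_diff_ge: "1 - norm z \<le> norm (p x - z)"
  using norm_triangle_ineq2[of "p x" z] p_sphere[of x] by simp

text \<open>Exponent 1 serves the Herglotz kernel, exponent 2 its derivative in
  \<open>z\<close>.\<close>

lemma integrable_kernel_power:
  assumes "norm z < 1"
  shows "integrable M (\<lambda>x. p x / (p x - z) ^ n)"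
proof (rule integrable_const_bound[where B = "1 / (1 - norm z) ^ n"])
  show "AE x in M. norm (p x / (p x - z) ^ n) \<le> 1 / (1 - norm z) ^ n"
    using assms norm_p_diff_ge
    by (intro AE_I2) (simp add: norm_divide norm_power p_sphere frac_le power_mono)
qed measurable

lemma integrable_herglotz:
  assumes "norm z < 1"
  shows "integrable M (\<lambda>x. (p x + z) / (p x - z))"
proof -
  have "(p x + z) / (p x - z) = 2 * (p x / (p x - z) ^ 1) - 1" for x
  proof -
    have "p x \<noteq> z" using assms p_sphere by force
    then show ?thesis by (simp add: divide_simps)
  qed
  moreover have "integrable M (\<lambda>x. 2 * (p x / (p x - z) ^ 1) - 1)"
    using assms
    by (intro Bochner_Integration.integrable_diff integrable_mult_right integrable_kernel_power) auto
  ultimately show ?thesis by simp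
qed

lemma integrable_poisson: "norm z < 1 \<Longrightarrow> integrable M (\<lambda>x. poisson_kernel (p x) z)"
  using integrable_Re[OF integrable_herglotz] by (simp add: Re_herglotz_kernel p_sphere)

lemma Re_herglotz: "norm z < 1 \<Longrightarrow> Re (herglotz z) = (\<integral>x. poisson_kernel (p x) z \<partial>M)"
  unfolding herglotz_def
  by (subst integral_Re[symmetric]) (auto simp: integrable_herglotz Re_herglotz_kernel p_sphere)

text \<open>Differentiation under the integral sign. The error of the difference quotient is the
  integral of an explicit rational function with a factor \<open>w - z\<close>, so a uniform bound
  on the remaining factor suffices and no limit theorem for integrals is used.\<close>

lemma herglotz_holomorphic: "herglotz holomorphic_on ball 0 1"
proof -
  have "(herglotz has_field_derivative (\<integral>x. 2 * (p x / (p x - z)\<^sup>2) \<partial>M)) (at z)"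
    if z: "z \<in> ball 0 1" for z
  proof -
    \<comment> \<open>Half the distance from \<open>z\<close> to the circle: any \<open>w\<close>
      within \<open>d\<close> of \<open>z\<close> is still at distance at least \<open>d\<close>
      from every pole \<open>p x\<close>.\<close>
    define d where "d = (1 - norm z) / 2"
    define D where "D = (\<integral>x. 2 * (p x / (p x - z)\<^sup>2) \<partial>M)"
    have d: "d > 0" using z by (simp add: d_def)
    define K where "K = 2 / d ^ 3 * measure M (space M)"
    have est: "norm ((herglotz w - herglotz z) / (w - z) - D) \<le> norm (w - z) * K"
      if w: "w \<noteq> z" "dist w z < d" for w
    proof -
      have "norm w \<le> norm z + dist w z"
        using norm_triangle_sub[of w z] by (simp add: dist_norm)
      then have nw: "d \<le> 1 - norm w" and nz: "d \<le> 1 - norm z" using w z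
        by (auto simp: d_def field_simps)
      have ge: "d \<le> norm (p x - w)" "d \<le> norm (p x - z)" for x
        using norm_p_diff_ge[of w x] norm_p_diff_ge[of z x] nw nz by linarith+
      have ne: "p x \<noteq> w" "p x \<noteq> z" for x
        using ge[of x] d by auto
      have int: "integrable M (\<lambda>x. (p x + w) / (p x - w))" "integrable M (\<lambda>x. (p x + z) / (p x - z))"
          "integrable M (\<lambda>x. 2 * (p x / (p x - z)\<^sup>2))"
        using nw d z by (intro integrable_herglotz integrable_mult_right integrable_kernel_power; simp)+
      have "(herglotz w - herglotz z) / (w - z) - D =
          (\<integral>x. ((p x + w) / (p x - w) - (p x + z) / (p x - z)) / (w - z) - 2 * (p x / (p x - z)\<^sup>2) \<partial>M)"
        unfolding herglotz_def D_def using int by simp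
      also have "\<dots> = (\<integral>x. (w - z) * (2 * p x / ((p x - w) * (p x - z)\<^sup>2)) \<partial>M)"
      proof (rule Bochner_Integration.integral_cong[OF refl])
        fix x
        have "p x - w \<noteq> 0" "p x - z \<noteq> 0" "w - z \<noteq> 0" using ne w by auto
        then show "((p x + w) / (p x - w) - (p x + z) / (p x - z)) / (w - z) - 2 * (p x / (p x - z)\<^sup>2)
            = (w - z) * (2 * p x / ((p x - w) * (p x - z)\<^sup>2))"
          by (simp add: divide_simps) (simp add: power2_eq_square algebra_simps)
      qed
      also have "norm \<dots> \<le> (\<integral>x. norm ((w - z) * (2 * p x / ((p x - w) * (p x - z)\<^sup>2))) \<partial>M)"
        by (rule integral_norm_bound)
      also have "\<dots> \<le> (\<integral>x. norm (w - z) * (2 / d ^ 3) \<partial>M)"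
      proof (rule integral_mono')
        fix x
        have "d ^ 3 \<le> norm (p x - w) * (norm (p x - z))\<^sup>2"
          unfolding power3_eq_cube power2_eq_square
          using ge[of x] d by (simp add: mult.assoc mult_mono)
        then have "2 / (norm (p x - w) * (norm (p x - z))\<^sup>2) \<le> 2 / d ^ 3"
          using d by (intro frac_le) auto
        then show "norm ((w - z) * (2 * p x / ((p x - w) * (p x - z)\<^sup>2))) \<le> norm (w - z) * (2 / d ^ 3)"
          unfolding norm_mult norm_divide norm_power p_sphere
          by (intro mult_left_mono) auto
      qed (use d in simp_all)
      also have "\<dots> = norm (w - z) * K" by (simp add: K_def)
      finally show ?thesis .
    qed
    have "((\<lambda>w. (herglotz w - herglotz z) / (w - z) - D) \<longlongrightarrow> 0) (at z)"
    proof (rule Lim_null_comparison)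
      show "\<forall>\<^sub>F w in at z. norm ((herglotz w - herglotz z) / (w - z) - D) \<le> norm (w - z) * K"
        using est d by (auto simp: eventually_at)
      show "((\<lambda>w. norm (w - z) * K) \<longlongrightarrow> 0) (at z)"
        by (auto intro!: tendsto_eq_intros)
    qed
    then show ?thesis
      unfolding has_field_derivative_iff D_def[symmetric] using LIM_zero_iff by blast
  qed
  then show ?thesis
    unfolding holomorphic_on_def field_differentiable_def
    by (meson has_field_derivative_at_within)
qed

lemma Re_herglotz_nonneg: "norm z < 1 \<Longrightarrow> 0 \<le> Re (herglotz z)"
  by (simp add: Re_herglotz poisson_kernel_nonneg)

text \<open>All poles stay a fixed distance away from \<open>\<xi>\<close>, so near
  \<open>\<xi>\<close> the kernels are bounded by a constant multiple of 1 - |z|^2, uniformly in the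
  pole.\<close>

lemma Re_herglotz_tendsto_0:
  assumes p: "\<And>x. p x \<in> E" and "closed E" and \<xi>: "\<xi> \<notin> E" "norm \<xi> = 1"
  shows "((\<lambda>z. Re (herglotz z)) \<longlongrightarrow> 0) (at \<xi> within ball 0 1)"
proof -
  obtain d where d: "d > 0" "\<And>e. e \<in> E \<Longrightarrow> d \<le> dist \<xi> e"
    using separate_point_closed[OF \<open>closed E\<close> \<xi>(1)] by blast
  define K where "K = measure M (space M) / (d / 2)\<^sup>2"
  show ?thesis
  proof (rule Lim_null_comparison)
    show "((\<lambda>z. (1 - (norm z)\<^sup>2) * K) \<longlongrightarrow> 0) (at \<xi> within ball 0 1)"
      using \<xi> by (auto intro!: tendsto_eq_intros)
    have "norm (Re (herglotz z)) \<le> (1 - (norm z)\<^sup>2) * K"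
      if z: "z \<in> ball 0 1" "dist z \<xi> < d / 2" for z
    proof -
      have nz: "norm z < 1" using z by simp
      then have nz2: "0 \<le> 1 - (norm z)\<^sup>2" by (simp add: abs_square_le_1)
      have "Re (herglotz z) = (\<integral>x. poisson_kernel (p x) z \<partial>M)"
        using nz by (rule Re_herglotz)
      also have "\<dots> \<le> (\<integral>x. (1 - (norm z)\<^sup>2) / (d / 2)\<^sup>2 \<partial>M)"
      proof (rule integral_mono)
        fix x
        have "d \<le> dist \<xi> (p x)" using d p by blast
        also have "\<dots> \<le> dist z \<xi> + norm (p x - z)"
          by (metis dist_commute dist_norm dist_triangle3 dist_triangle)
        finally have "d / 2 \<le> norm (p x - z)" using z by linarith
        then show "poisson_kernel (p x) z \<le> (1 - (norm z)\<^sup>2) / (d / 2)\<^sup>2"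
          unfolding poisson_kernel_def using nz2 d
          by (intro divide_left_mono power_mono mult_pos_pos zero_less_power) auto
      qed (use nz in \<open>auto intro: integrable_poisson\<close>)
      also have "\<dots> = (1 - (norm z)\<^sup>2) * K" by (simp add: K_def)
      finally show ?thesis using Re_herglotz_nonneg[OF nz] by simp
    qed
    then show "\<forall>\<^sub>F z in at \<xi> within ball 0 1. norm (Re (herglotz z)) \<le> (1 - (norm z)\<^sup>2) * K"
      using d by (auto simp: eventually_at intro!: exI[of _ "d / 2"])
  qed
qed

text \<open>Either \<open>s *\<^sub>R z\<close> lies in the region of \<open>lower\<close>, which
  gives the bound at once, or every kernel with pole in \<open>E\<close> is at least as large there
  as at \<open>z\<close>, and integrating compares the two values.\<close>

lemma starlike_Re_herglotz:
  assumes p: "\<And>x. p x \<in> E"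
    and lower: "\<And>z e. norm z < 1 \<Longrightarrow> e \<in> E \<Longrightarrow>
        (1 + (norm z)\<^sup>2) * (norm (e - z))\<^sup>2 \<le> (1 - (norm z)\<^sup>2)\<^sup>2 \<Longrightarrow> c < Re (herglotz z)"
    and z: "norm z < 1" "c < Re (herglotz z)" and s: "0 \<le> s" "s \<le> 1"
  shows "c < Re (herglotz (s *\<^sub>R z))"
proof -
  have nsz: "norm (s *\<^sub>R z) < 1"
    using s z(1) mult_left_le_one_le[of "norm z" s] by simp
  show ?thesis
  proof (cases "\<exists>e\<in>E. (1 + (norm (s *\<^sub>R z))\<^sup>2) * (norm (e - s *\<^sub>R z))\<^sup>2 \<le> (1 - (norm (s *\<^sub>R z))\<^sup>2)\<^sup>2")
    case True
    then show ?thesis using lower nsz by blast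
  next
    case False
    have "Re (herglotz z) \<le> Re (herglotz (s *\<^sub>R z))"
      unfolding Re_herglotz[OF z(1)] Re_herglotz[OF nsz]
    proof (rule integral_mono)
      fix x
      show "poisson_kernel (p x) z \<le> poisson_kernel (p x) (s *\<^sub>R z)"
        using False p[of x] p_sphere z(1) s
        by (intro poisson_kernel_radial_decreasing) (auto simp: not_le simp del: norm_scaleR)
    qed (use nsz z in \<open>auto intro: integrable_poisson\<close>)
    then show ?thesis using z by simp
  qed
qed

text \<open>The modulus of \<open>b\<close> is exp (- Re \<open>herglotz\<close>), so superlevel
  sets of the Poisson integral become sublevel sets of the modulus, and \<open>exp (- c)\<close>
  serves as the constant C.\<close>

lemma one_component_exp_herglotz:
  assumes p: "\<And>x. p x \<in> E" and E: "closed E" "E \<subset> sphere 0 1" and c: "0 < c"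
    and lower: "\<And>z e. norm z < 1 \<Longrightarrow> e \<in> E \<Longrightarrow>
        (1 + (norm z)\<^sup>2) * (norm (e - z))\<^sup>2 \<le> (1 - (norm z)\<^sup>2)\<^sup>2 \<Longrightarrow> c < Re (herglotz z)"
  defines "b \<equiv> \<lambda>z. exp (- herglotz z)"
  shows "one_component b \<and> spec b = E"
proof -
  have nb: "norm (b z) = exp (- Re (herglotz z))" for z
    by (simp add: b_def)
  have nb1: "norm (b z) \<le> 1" if "norm z < 1" for z
    using Re_herglotz_nonneg[OF that] by (simp add: nb)
  have nontriv: "at \<xi> within ball 0 1 \<noteq> bot" if "norm \<xi> = 1" for \<xi> :: complex
    using that islimpt_ball[of \<xi> 0 1] by (simp add: trivial_limit_within)
  have lim: "((\<lambda>z. norm (b z)) \<longlongrightarrow> 1) (at \<xi> within ball 0 1)" if "norm \<xi> = 1" "\<xi> \<notin> E" for \<xi>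
    unfolding nb using tendsto_exp[OF tendsto_minus[OF Re_herglotz_tendsto_0[OF p E(1) that(2,1)]]]
    by simp
  \<comment> \<open>Radii ending in \<open>E\<close> lie in the region of \<open>lower\<close>,
    because |\<xi> - r \<xi>| = 1 - r and 1 + r^2 \<le> (1 + r)^2.\<close>
  have radius: "c < Re (herglotz (r *\<^sub>R \<xi>))" if "\<xi> \<in> E" "0 \<le> r" "r < 1" for \<xi> r
  proof (rule lower)
    have \<xi>: "norm \<xi> = 1" using that E by auto
    have "\<xi> - r *\<^sub>R \<xi> = (1 - r) *\<^sub>R \<xi>" by (simp add: algebra_simps)
    then have "norm (\<xi> - r *\<^sub>R \<xi>) = 1 - r" using \<xi> that by simp
    moreover have "(1 + r\<^sup>2) * (1 - r)\<^sup>2 \<le> (1 + r)\<^sup>2 * (1 - r)\<^sup>2"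
      using that by (intro mult_right_mono) (auto simp: power2_sum)
    moreover have "(1 + r)\<^sup>2 * (1 - r)\<^sup>2 = (1 - r\<^sup>2)\<^sup>2"
      by (simp add: power2_eq_square algebra_simps)
    moreover have "norm (r *\<^sub>R \<xi>) = r" using \<xi> that by simp
    ultimately show "(1 + (norm (r *\<^sub>R \<xi>))\<^sup>2) * (norm (\<xi> - r *\<^sub>R \<xi>))\<^sup>2 \<le> (1 - (norm (r *\<^sub>R \<xi>))\<^sup>2)\<^sup>2"
      by metis
    show "norm (r *\<^sub>R \<xi>) < 1" using \<xi> that by simp
  qed (use that in auto)
  have approach: "filterlim (\<lambda>r. r *\<^sub>R \<xi>) (at \<xi> within ball 0 1) (at_left (1::real))"
    if "norm \<xi> = 1" for \<xi> :: complex
  proof -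
    have "((\<lambda>r. r *\<^sub>R \<xi>) \<longlongrightarrow> \<xi>) (at_left (1::real))"
      by (auto intro!: tendsto_eq_intros)
    moreover have "\<forall>\<^sub>F r in at_left (1::real). r *\<^sub>R \<xi> \<in> ball 0 1 \<and> r *\<^sub>R \<xi> \<noteq> \<xi>"
      using eventually_at_left_real[of 0 "1::real", simplified]
    proof eventually_elim
      case (elim r)
      then have "norm (r *\<^sub>R \<xi>) < 1" using that by simp
      moreover from this have "r *\<^sub>R \<xi> \<noteq> \<xi>" using that by (metis less_irrefl)
      ultimately show ?case by simp
    qed
    ultimately show ?thesis by (simp add: filterlim_at)
  qed
  have spec: "spec b = E"
  proof (intro equalityI subsetI)
    fix \<xi> assume \<xi>: "\<xi> \<in> spec b"
    show "\<xi> \<in> E"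
    proof (rule ccontr)
      assume "\<xi> \<notin> E"
      then have "((\<lambda>z. ereal (norm (b z))) \<longlongrightarrow> ereal 1) (at \<xi> within ball 0 1)"
        using lim \<xi> by (intro tendsto_ereal) (auto simp: spec_def)
      then have "Liminf (at \<xi> within ball 0 1) (\<lambda>z. ereal (norm (b z))) = ereal 1"
        using \<xi> nontriv by (intro lim_imp_Liminf) (auto simp: spec_def)
      then show False using \<xi> by (simp add: spec_def one_ereal_def)
    qed
  next
    fix \<xi> assume \<xi>: "\<xi> \<in> E"
    then have n\<xi>: "norm \<xi> = 1" using E by auto
    \<comment> \<open>A larger lower limit would force the modulus above \<open>exp (- c)\<close>
      throughout a neighbourhood of \<open>\<xi>\<close> in the disc, but the radius to
      \<open>\<xi>\<close> enters that neighbourhood.\<close>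
    have "Liminf (at \<xi> within ball 0 1) (\<lambda>z. ereal (norm (b z))) \<le> ereal (exp (- c))"
    proof (rule ccontr)
      assume "\<not> ?thesis"
      then have "\<forall>\<^sub>F z in at \<xi> within ball 0 1. ereal (exp (- c)) < ereal (norm (b z))"
        by (intro less_LiminfD) (simp add: not_le)
      then have "\<forall>\<^sub>F r in at_left (1::real). ereal (exp (- c)) < ereal (norm (b (r *\<^sub>R \<xi>)))"
        using approach[OF n\<xi>] by (auto simp: filterlim_iff)
      moreover have "\<forall>\<^sub>F r in at_left (1::real). 0 < r \<and> r < 1"
        using eventually_at_left_real[of 0 "1::real"] by simp
      ultimately have "\<forall>\<^sub>F r in at_left (1::real). False"
      proof eventually_elim
        case (elim r)
        then show False using radius[OF \<xi>, of r] by (simp add: nb)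
      qed
      then show False by simp
    qed
    also have "\<dots> < 1" using c by (simp add: one_ereal_def)
    finally show "\<xi> \<in> spec b" using n\<xi> by (simp add: spec_def)
  qed
  have hinf: "Hinf_unit b"
    unfolding Hinf_unit_def
  proof (intro conjI)
    show "b holomorphic_on ball 0 1"
      unfolding b_def by (intro holomorphic_intros herglotz_holomorphic)
    show "bounded (b ` ball 0 1)"
      using nb1 by (auto simp: bounded_iff intro!: exI[of _ 1])
    show "(SUP z\<in>ball 0 1. norm (b z)) = 1"
    proof (rule cSup_eq_non_empty)
      fix y assume y: "\<And>x. x \<in> (\<lambda>z. norm (b z)) ` ball 0 1 \<Longrightarrow> x \<le> y"
      \<comment> \<open>Properness of \<open>E\<close> supplies a boundary point at which the
        modulus tends to 1, so no bound below 1 is possible.\<close>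
      obtain \<xi> where \<xi>: "norm \<xi> = 1" "\<xi> \<notin> E" using psubset_imp_ex_mem[OF E(2)] by auto
      show "1 \<le> y"
      proof (rule tendsto_upperbound[OF lim[OF \<xi>] _ nontriv[OF \<xi>(1)]])
        show "\<forall>\<^sub>F z in at \<xi> within ball 0 1. norm (b z) \<le> y"
          using y by (auto simp: eventually_at intro!: exI[of _ 1])
      qed
    qed (use nb1 in auto)
  qed
  have "E \<subseteq> closure {z \<in> ball 0 1. norm (b z) \<le> exp (- c)}"
  proof
    fix \<xi> assume \<xi>: "\<xi> \<in> E"
    have "((\<lambda>r. r *\<^sub>R \<xi>) \<longlongrightarrow> \<xi>) (at_left (1::real))"
      by (auto intro!: tendsto_eq_intros)
    moreover have "\<forall>\<^sub>F r in at_left (1::real). r *\<^sub>R \<xi> \<in> closure {z \<in> ball 0 1. norm (b z) \<le> exp (- c)}"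
      using eventually_at_left_real[of 0 "1::real", simplified]
    proof eventually_elim
      case (elim r)
      then have "norm (r *\<^sub>R \<xi>) < 1" using \<xi> E(2) by auto
      then show ?case
        using radius[OF \<xi>, of r] elim by (intro closure_subset[THEN subsetD]) (auto simp: nb)
    qed
    ultimately show "\<xi> \<in> closure {z \<in> ball 0 1. norm (b z) \<le> exp (- c)}"
      by (intro Lim_in_closed_set[OF closed_closure]) auto
  qed
  moreover have "connected {z \<in> ball 0 1. norm (b z) < exp (- c)}" (is "connected ?S")
  proof (rule starlike_imp_connected)
    \<comment> \<open>Any value of \<open>p\<close> is a point of \<open>E\<close>, and the radius
      to it starts at 0.\<close>
    have 0: "0 \<in> ?S" using p radius[of _ 0] by (auto simp: nb)
    moreover have "closed_segment 0 z \<subseteq> ?S" if z: "z \<in> ?S" for z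
    proof
      fix w assume "w \<in> closed_segment 0 z"
      then obtain s where s: "0 \<le> s" "s \<le> 1" "w = s *\<^sub>R z" by (auto simp: in_segment)
      have "norm w < 1" using s z mult_left_le_one_le[of "norm z" s] by simp
      moreover have "c < Re (herglotz w)"
        unfolding s(3) using s z by (intro starlike_Re_herglotz[OF p lower]) (auto simp: nb)
      ultimately show "w \<in> ?S" by (simp add: nb)
    qed
    ultimately show "starlike ?S" unfolding starlike_def by blast
  qed
  ultimately show ?thesis
    unfolding one_component_def using hinf spec c by (auto intro!: exI[of _ "exp (- c)"])
qed

end

section \<open>The measure carried by a given closed set\<close>

lemma norm_cis_diff_le: "norm (cis x - cis y) \<le> \<bar>x - y\<bar>"
proof -
  have "norm (cis x - cis y) = norm (cis y * (cis (x - y) - 1))"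
    by (simp add: algebra_simps cis_mult)
  also have "\<dots> = 2 * \<bar>sin ((x - y) / 2)\<bar>"
    using dist_exp_i_1[of "x - y"] by (simp add: norm_mult cis_conv_exp)
  also have "\<dots> \<le> \<bar>x - y\<bar>"
    using abs_sin_x_le_abs_x[of "(x - y) / 2"] by simp
  finally show ?thesis .
qed

theorem theorem1p2:
  fixes E :: "complex set"
  assumes "closed E" and "E \<subset> sphere 0 1"
  shows "\<exists>b. one_component b \<and> spec b = E"
proof (cases "E = {}")
  \<comment> \<open>There is no point to carry a measure. The constant 1 has empty spectrum, and its
    sublevel set for C = 1/2 is empty, hence connected.\<close>
  case True
  have spec: "spec (\<lambda>z. 1) = {}"
  proof -
    have "Liminf (at \<xi> within ball 0 1) (\<lambda>z. ereal 1) = ereal 1" if "norm \<xi> = 1" for \<xi> :: complex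
      using that islimpt_ball[of \<xi> 0 1] by (intro Liminf_const) (simp add: trivial_limit_within)
    then show ?thesis by (auto simp: spec_def one_ereal_def)
  qed
  have "one_component (\<lambda>z. 1)"
    unfolding one_component_def Hinf_unit_def spec
    by (auto simp: image_constant_conv intro!: exI[of _ "1/2"])
  then show ?thesis using spec True by blast
next
  case False
  define A where "A = {t \<in> {0..2 * pi}. cis t \<in> E}"
  \<comment> \<open>The last angle of \<open>E\<close> up to \<open>t\<close>. Inserting
    \<open>Inf A\<close> gives the supremum a value in \<open>A\<close> also when \<open>t\<close>
    precedes all angles, and keeps \<open>m\<close> monotone, from which its measurability
    follows.\<close>
  define m where "m t = Sup (insert (Inf A) (A \<inter> {..t}))" for t
  have angle: "\<exists>t\<in>A. e = cis t" if "e \<in> E" for e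
  proof -
    have "norm e = 1" using that assms by auto
    then have "e = cis (Arg2pi e)"
      using Arg2pi_eq[of e] by (simp add: cis_conv_exp)
    moreover have "Arg2pi e \<in> {0..2 * pi}"
      using Arg2pi_ge_0[of e] Arg2pi_lt_2pi[of e] by simp
    ultimately show ?thesis using that by (auto simp: A_def)
  qed
  have "closed A"
  proof -
    have "A = {0..2 * pi} \<inter> cis -` E" by (auto simp: A_def)
    moreover have "closed (cis -` E)"
      using assms(1) by (intro closed_vimage continuous_intros)
    ultimately show ?thesis by auto
  qed
  have A: "A \<noteq> {}" "bdd_below A" "bdd_above A" "A \<subseteq> {0..2 * pi}"
    using False angle by (auto simp: A_def bdd_below_def bdd_above_def)
  have InfA: "Inf A \<in> A" using A \<open>closed A\<close> by (intro closed_contains_Inf) auto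
  have bdd: "bdd_above (insert (Inf A) (A \<inter> {..t}))" for t
    using A by (auto intro: bdd_above_mono)
  have mA: "m t \<in> A" for t
  proof -
    have "m t \<in> insert (Inf A) (A \<inter> {..t})"
      unfolding m_def using \<open>closed A\<close> bdd by (intro closed_contains_Sup closed_insert closed_Int) auto
    then show ?thesis using InfA by auto
  qed
  have "mono m"
    unfolding m_def by (intro monoI cSup_subset_mono bdd) auto
  then have [measurable]: "m \<in> borel_measurable borel" by (rule borel_measurable_mono)
  \<comment> \<open>\<open>8 \<ge> 2 * pi + 1\<close> leaves room for an interval of length at most \<open>1\<close> to the right of any angle of \<open>E\<close>.\<close>
  define M where "M = restrict_space lborel {0..8::real}"
  have [measurable]: "(\<lambda>t. cis (m t)) \<in> borel_measurable M"
  proof -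
    have "cis \<in> borel_measurable borel"
      by (intro borel_measurable_continuous_onI continuous_intros)
    then have "(\<lambda>t. cis (m t)) \<in> borel_measurable lborel" by measurable
    then show ?thesis unfolding M_def by (rule measurable_restrict_space1)
  qed
  interpret circle_measure M "\<lambda>t. cis (m t)"
  proof (intro circle_measure.intro finite_measureI circle_measure_axioms.intro)
    show "emeasure M (space M) \<noteq> \<infinity>"
      by (simp add: M_def space_restrict_space emeasure_restrict_space)
  qed auto
  \<comment> \<open>The angles in an interval of length \<open>h\<close> to the right of an angle of
    \<open>e\<close> are sent to poles within 2 h of \<open>z\<close>. Each such kernel is at least
    h / (2 h)^2 = 1 / (4 h), so the interval contributes at least 1/4; the smaller 1/8 makes the
    inequality strict.\<close>
  have lower: "1 / 8 < Re (herglotz z)"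
    if z: "norm z < 1" and e: "e \<in> E"
      and near: "(1 + (norm z)\<^sup>2) * (norm (e - z))\<^sup>2 \<le> (1 - (norm z)\<^sup>2)\<^sup>2" for z e
  proof -
    define h where "h = 1 - (norm z)\<^sup>2"
    have h: "0 < h" "h \<le> 1" using z by (auto simp: h_def abs_square_less_1)
    have "1 * (norm (e - z))\<^sup>2 \<le> (1 + (norm z)\<^sup>2) * (norm (e - z))\<^sup>2"
      by (intro mult_right_mono) auto
    then have "(norm (e - z))\<^sup>2 \<le> h\<^sup>2" using near unfolding h_def by linarith
    then have eh: "norm (e - z) \<le> h" using h(1) by (rule power2_le_imp_le[OF _ less_imp_le])
    obtain \<theta> where \<theta>: "\<theta> \<in> A" "e = cis \<theta>" using angle[OF e] by blast
    have "0 \<le> \<theta>" "\<theta> \<le> 2 * pi" using \<theta>(1) A(4) by auto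
    then have sub: "{\<theta>..\<theta> + h} \<subseteq> {0..8}" using h(2) pi_approx(2) by auto
    have "measure M {\<theta>..\<theta> + h} = h"
      unfolding M_def using sub h by (subst measure_restrict_space) auto
    moreover have meas: "{\<theta>..\<theta> + h} \<in> sets M"
      unfolding M_def using sub by (subst sets_restrict_space_iff) auto
    ultimately have "1 / 4 = (\<integral>t. indicator {\<theta>..\<theta> + h} t * (1 / (4 * h)) \<partial>M)"
      using h by (simp add: sets.Int_space_eq2)
    also have "\<dots> \<le> (\<integral>t. poisson_kernel (cis (m t)) z \<partial>M)"
    proof (rule integral_mono)
      show "integrable M (\<lambda>t. indicator {\<theta>..\<theta> + h} t * (1 / (4 * h)))"
        using meas by (intro integrable_mult_left integrable_real_indicator) (auto simp: less_top[symmetric])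
      show "integrable M (\<lambda>t. poisson_kernel (cis (m t)) z)"
        using z by (rule integrable_poisson)
      fix t
      show "indicator {\<theta>..\<theta> + h} t * (1 / (4 * h)) \<le> poisson_kernel (cis (m t)) z"
      proof (cases "t \<in> {\<theta>..\<theta> + h}")
        case True
        \<comment> \<open>Here \<open>\<theta>\<close> is itself an angle of \<open>E\<close> not
          beyond \<open>t\<close>, so moving back from \<open>t\<close> to the last such angle
          cannot pass \<open>\<theta>\<close>.\<close>
        have "\<theta> \<le> m t"
          unfolding m_def using True \<theta> bdd by (intro cSup_upper) auto
        moreover have "m t \<le> t"
          unfolding m_def using True \<theta> A cInf_lower[of \<theta> A] by (intro cSup_least) auto
        ultimately have "\<bar>m t - \<theta>\<bar> \<le> h" using True by auto
        then have "norm (cis (m t) - e) \<le> h"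
          using norm_cis_diff_le[of "m t" \<theta>] \<theta> by simp
        then have "norm (cis (m t) - z) \<le> 2 * h"
          using eh norm_triangle_ineq[of "cis (m t) - e" "e - z"] by simp
        moreover have "cis (m t) \<noteq> z" using z by force
        ultimately have "h / (2 * h)\<^sup>2 \<le> h / (norm (cis (m t) - z))\<^sup>2"
          using h by (intro divide_left_mono power_mono) auto
        then show ?thesis using True h
          unfolding poisson_kernel_def h_def[symmetric] by (simp add: power_mult_distrib power2_eq_square[of h])
      next
        case False
        then show ?thesis using z by (simp add: poisson_kernel_nonneg)
      qed
    qed
    finally show ?thesis using z by (simp add: Re_herglotz)
  qed
  have "cis (m t) \<in> E" for t using mA[of t] by (simp add: A_def)
  then have "one_component (\<lambda>z. exp (- herglotz z)) \<and> spec (\<lambda>z. exp (- herglotz z)) = E"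
    using one_component_exp_herglotz[OF _ assms _ lower] by simp
  then show ?thesis by blast
qed

end
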